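(* Let $u\in K$ be the solution of $$\langle Au-\ell, v-u\rangle\ge 0\quad\text{for all } v\in K,$$ and let $\tilde u\in\widetilde K$ be the solution of $$\langle \widetilde A\tilde u-\tilde\ell,\tilde v-\tilde u\rangle\ge 0\quad\text{for all }\tilde v\in\widetilde K .$$ Then $$\|u-\tilde u\|_V^2\le\Big(2+\frac{4c^2}{\tilde\alpha^2}\Big)\|u-\tilde v\|_V^2+\frac{4}{\tilde\alpha}\langle Au-\ell,\ \tilde v-u+v-\tilde u\rangle+\frac{4}{\tilde\alpha^2}\|(A-\widetilde A)\tilde v-(\ell-\tilde\ell)\|_{\widetilde V^*}^2$$ for all $v\in K$ and all $\tilde v\in\widetilde K$.
   Context: $V$ is a real Hilbert space with dual $V^*$; $\widetilde V\subset V$ is a second Hilbert space (a linear subspace of $V$) with dual $\widetilde V^*$, and $\|\tilde v\|_{\widetilde V}=\|\tilde v\|_V$ for all $\tilde v\in\widetilde V$. Elements of $V^*$ are regarded as elements of $\widetilde V^*$ by restriction to $\widetilde V$. $K\subset V$ and $\widetilde K\subset\widetilde V$ are closed, non-empty and convex ($\widetilde K$ is not assumed to be contained in $K$). $\ell\in V^*$ and $\tilde\ell\in\widetilde V^*$ are given. $\langle\cdot,\cdot\rangle$ denotes the duality pairing between any space and its dual. $A:V\to V^*$ and $\widetilde A:\widetilde V\to\widetilde V^*$ are linear, continuous and elliptic: there are constants $c,\tilde c,\alpha,\tilde\alpha>0$ such that $\|Av\|_{V^*}\le c\|v\|_V$, $\langle Av,v\rangle\ge\alpha\|v\|_V^2$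 for all $v\in V$, and $\|\widetilde A\tilde v\|_{\widetilde V^*}\le\tilde c\|\tilde v\|_{\widetilde V}$, $\langle\widetilde A\tilde v,\tilde v\rangle\ge\tilde\alpha\|\tilde v\|_{\widetilde V}^2$ for all $\tilde v\in\widetilde V$. Under these assumptions both variational inequalities have unique solutions. *)

theory Defs
  imports "HOL-Analysis.Analysis"
begin

(* The dual of a linear subspace S with the inherited norm. Only the values of f on S matter:
   two functions that agree on S represent the same element of the dual, and restricting
   a functional on the whole space to S does not change the underlying function. *)
definition dual_on :: "'v::real_normed_vector set \<Rightarrow> ('v \<Rightarrow> real) set" where
  "dual_on S = {f.
     (\<forall>x\<in>S. \<forall>y\<in>S. f (x + y) = f x + f y) \<and>
     (\<forall>r. \<forall>x\<in>S. f (r *\<^sub>R x) = r * f x) \<and>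
     (\<exists>C. \<forall>x\<in>S. \<bar>f x\<bar> \<le> C * norm x)}"

(* The same formula as onorm, with the supremum taken over S; the value 0 / 0 = 0 at x = 0
   is harmless. Meaningful for f in dual_on S, where the supremum is finite. *)
definition dual_norm_on :: "'v::real_normed_vector set \<Rightarrow> ('v \<Rightarrow> real) \<Rightarrow> real" where
  "dual_norm_on S f = (SUP x\<in>S. \<bar>f x\<bar> / norm x)"

(* Linear continuous maps from S to its dual; equality in the dual is equality on S. *)
definition bounded_linear_to_dual_on ::
    "'v::real_normed_vector set \<Rightarrow> ('v \<Rightarrow> 'v \<Rightarrow> real) \<Rightarrow> bool" where
  "bounded_linear_to_dual_on S B \<longleftrightarrow>
     (\<forall>x\<in>S. B x \<in> dual_on S) \<and>
     (\<forall>x\<in>S. \<forall>y\<in>S. \<forall>z\<in>S. B (x + y) z = B x z + B y z) \<and>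
     (\<forall>r. \<forall>x\<in>S. \<forall>z\<in>S. B (r *\<^sub>R x) z = r * B x z) \<and>
     (\<exists>C. \<forall>x\<in>S. dual_norm_on S (B x) \<le> C * norm x)"

end

theory Submission imports Defs begin

text \<open>The estimate is a Strang-type argument. The error is split as
  \<open>u - ut = (u - vt) + w\<close> with \<open>w = vt - ut\<close>, which lies in the subspace \<open>Vt\<close>, so that the
  ellipticity of \<open>At\<close> applies to \<open>w\<close>. Testing the second variational inequality with \<open>vt\<close> replaces
  \<open>At ut w\<close> by \<open>lt w\<close>, which gives \<open>\<alpha>t \<parallel>w\<parallel>\<^sup>2 \<le> At vt w - lt w\<close>.
  With the residual \<open>R = (A vt - At vt) - (l - lt)\<close>, the right-hand side is
  \<open>-R w + A (vt - u) w + (A u - l) w\<close>. The first two terms are at most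
  \<open>(\<parallel>R\<parallel> + c \<parallel>u - vt\<parallel>) \<parallel>w\<parallel>\<close> and Young's inequality absorbs their dependence on \<open>\<parallel>w\<parallel>\<close>
  (\<open>young_absorb\<close>). The last term is a first-order consistency error; the first variational
  inequality allows adding the nonnegative number \<open>(A u - l) (v - u)\<close> to it, with \<open>v \<in> K\<close>
  free. This freedom is what makes \<open>ut\<close>, which need not lie in \<open>K\<close>, comparable with an element
  of \<open>K\<close>.

  The residual is only measured on \<open>Vt\<close>, so the bound \<open>\<bar>R w\<bar> \<le> \<parallel>R\<parallel> \<parallel>w\<parallel>\<close> has to be derived for the
  supremum over \<open>Vt\<close> (\<open>dual_norm_on_bound\<close>); it rests on \<open>R\<close> being bounded there, since the
  supremum of an unbounded set of reals carries no information.\<close>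

lemma dual_on_diff:
  assumes "f \<in> dual_on S" "g \<in> dual_on S"
  shows "(\<lambda>x. f x - g x) \<in> dual_on S"
proof -
  obtain C D where "\<forall>x\<in>S. \<bar>f x\<bar> \<le> C * norm x" "\<forall>x\<in>S. \<bar>g x\<bar> \<le> D * norm x"
    using assms unfolding dual_on_def by blast
  then have "\<forall>x\<in>S. \<bar>f x - g x\<bar> \<le> (C + D) * norm x"
    by (fastforce simp: distrib_right)
  with assms show ?thesis
    unfolding dual_on_def by (auto simp: right_diff_distrib)
qed

lemma blinfun_in_dual_on: "blinfun_apply f \<in> dual_on S"
  unfolding dual_on_def
  using norm_blinfun[of f] by (auto simp: blinfun.add_right blinfun.scaleR_right)

text \<open>Boundedness of \<open>f\<close> makes the set of quotients bounded above, so that its supremum dominates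
  each quotient; at \<open>x = 0\<close>, where the quotient says nothing, homogeneity gives \<open>f 0 = 0\<close>.\<close>
lemma dual_norm_on_bound:
  assumes f: "f \<in> dual_on S" and x: "x \<in> S"
  shows "\<bar>f x\<bar> \<le> dual_norm_on S f * norm x"
proof (cases "x = 0")
  case True
  have "f (0 *\<^sub>R x) = 0 * f x"
    using f x unfolding dual_on_def by blast
  with True show ?thesis by simp
next
  case False
  obtain C where C: "\<forall>y\<in>S. \<bar>f y\<bar> \<le> C * norm y"
    using f unfolding dual_on_def by blast
  have "\<bar>f y\<bar> / norm y \<le> max C 0" if "y \<in> S" for y
  proof (cases "y = 0")
    case False
    then have "\<bar>f y\<bar> / norm y \<le> C"
      using C that by (simp add: divide_le_eq)
    then show ?thesis by simp
  qed simp
  then have "bdd_above ((\<lambda>y. \<bar>f y\<bar> / norm y) ` S)"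
    by (rule bdd_aboveI2)
  then have "\<bar>f x\<bar> / norm x \<le> dual_norm_on S f"
    unfolding dual_norm_on_def using x by (rule cSUP_upper2) simp
  with False show ?thesis by (simp add: divide_le_eq)
qed

lemma norm_add_sq_le:
  fixes x y :: "'v::real_normed_vector"
  shows "(norm (x + y))\<^sup>2 \<le> 2 * (norm x)\<^sup>2 + 2 * (norm y)\<^sup>2"
proof -
  have "(norm (x + y))\<^sup>2 \<le> (norm x + norm y)\<^sup>2"
    by (simp add: norm_triangle_ineq power_mono)
  also have "\<dots> \<le> 2 * (norm x)\<^sup>2 + 2 * (norm y)\<^sup>2"
    using zero_le_power2[of "norm x - norm y"] by (simp add: power2_eq_square algebra_simps)
  finally show ?thesis .
qed

text \<open>Half of the quadratic term on the left absorbs the linear one, by Young's inequality with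
  weight \<open>a\<close>. Multiplied by \<open>a\<^sup>2\<close>, the gap between the two sides of the conclusion is at least
  \<open>(a t - (p + q))\<^sup>2 + (p - q)\<^sup>2\<close>, the second square being the loss in
  \<open>(p + q)\<^sup>2 \<le> 2 p\<^sup>2 + 2 q\<^sup>2\<close>.\<close>
lemma young_absorb:
  fixes a t p q X :: real
  assumes a: "a > 0" and le: "a * t\<^sup>2 \<le> (p + q) * t + X"
  shows "t\<^sup>2 \<le> 2 / a\<^sup>2 * (p\<^sup>2 + q\<^sup>2) + 2 / a * X"
proof -
  have "2 * a * (a * t\<^sup>2) \<le> 2 * a * ((p + q) * t + X)"
    using a le by (intro mult_left_mono) auto
  then have "a\<^sup>2 * t\<^sup>2 \<le> 2 * (p\<^sup>2 + q\<^sup>2) + 2 * a * X"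
    using zero_le_power2[of "a * t - (p + q)"] zero_le_power2[of "p - q"]
    by (simp add: power2_eq_square algebra_simps)
  then have "t\<^sup>2 \<le> (2 * (p\<^sup>2 + q\<^sup>2) + 2 * a * X) / a\<^sup>2"
    using a by (simp add: le_divide_eq mult.commute)
  also have "\<dots> = 2 / a\<^sup>2 * (p\<^sup>2 + q\<^sup>2) + 2 / a * X"
    using a by (simp add: power2_eq_square field_simps)
  finally show ?thesis .
qed

theorem theorem1:
  fixes Vt :: "'v::{real_inner, complete_space} set"
    and K Kt :: "'v set"
    and A :: "'v \<Rightarrow> 'v \<Rightarrow>\<^sub>L real" and l :: "'v \<Rightarrow>\<^sub>L real"
    and At :: "'v \<Rightarrow> 'v \<Rightarrow> real" and lt :: "'v \<Rightarrow> real"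
    and c ct \<alpha> \<alpha>t :: real
    and u ut :: 'v
  assumes Vt: "subspace Vt" "complete Vt"
    and K: "closed K" "K \<noteq> {}" "convex K"
    and Kt: "Kt \<subseteq> Vt" "closedin (top_of_set Vt) Kt" "Kt \<noteq> {}" "convex Kt"
    and lt: "lt \<in> dual_on Vt"
    and A: "bounded_linear A"
    and At: "bounded_linear_to_dual_on Vt At"
    and const_pos: "c > 0" "ct > 0" "\<alpha> > 0" "\<alpha>t > 0"
    and A_bound: "\<forall>v. norm (A v) \<le> c * norm v"
    and A_elliptic: "\<forall>v. blinfun_apply (A v) v \<ge> \<alpha> * (norm v)\<^sup>2"
    and At_bound: "\<forall>w\<in>Vt. dual_norm_on Vt (At w) \<le> ct * norm w"
    and At_elliptic: "\<forall>w\<in>Vt. At w w \<ge> \<alpha>t * (norm w)\<^sup>2"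
    and u: "u \<in> K" "\<forall>v\<in>K. blinfun_apply (A u - l) (v - u) \<ge> 0"
    and ut: "ut \<in> Kt" "\<forall>vt\<in>Kt. At ut (vt - ut) - lt (vt - ut) \<ge> 0"
  shows "\<forall>v\<in>K. \<forall>vt\<in>Kt.
    (norm (u - ut))\<^sup>2 \<le>
      (2 + 4 * c\<^sup>2 / \<alpha>t\<^sup>2) * (norm (u - vt))\<^sup>2
      + 4 / \<alpha>t * blinfun_apply (A u - l) (vt - u + v - ut)
      + 4 / \<alpha>t\<^sup>2 *
          (dual_norm_on Vt (\<lambda>w. (blinfun_apply (A vt) w - At vt w)
                                  - (blinfun_apply l w - lt w)))\<^sup>2"
proof (intro ballI)
  fix v vt
  assume v: "v \<in> K" and vt: "vt \<in> Kt"
  define R where "R = (\<lambda>w. (blinfun_apply (A vt) w - At vt w) - (blinfun_apply l w - lt w))"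
  define w where "w = vt - ut"
  define d where "d = norm (u - vt)"
  define X where "X = blinfun_apply (A u - l) (vt - u + v - ut)"
  have vtV: "vt \<in> Vt" and utV: "ut \<in> Vt"
    using vt ut(1) Kt(1) by auto
  then have wV: "w \<in> Vt"
    unfolding w_def by (rule subspace_diff[OF Vt(1)])

  have "At vt \<in> dual_on Vt"
    using At vtV unfolding bounded_linear_to_dual_on_def by blast
  then have "R \<in> dual_on Vt"
    unfolding R_def by (intro dual_on_diff blinfun_in_dual_on lt)
  then have R_bound: "\<bar>R w\<bar> \<le> dual_norm_on Vt R * norm w"
    using wV by (rule dual_norm_on_bound)

  have At_split: "At vt w = At w w + At ut w"
  proof -
    have "At (w + ut) w = At w w + At ut w"
      using At wV utV unfolding bounded_linear_to_dual_on_def by blast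
    then show ?thesis by (simp add: w_def)
  qed
  have test_ut: "At ut w - lt w \<ge> 0"
    using ut(2) vt by (simp add: w_def)

  have A_diff: "A (vt - u) = A vt - A u"
    using A by (simp add: bounded_linear.linear linear_diff)
  have "blinfun_apply (A (vt - u)) w \<le> norm (A (vt - u)) * norm w"
    using norm_blinfun[of "A (vt - u)" w] by simp
  also have "\<dots> \<le> (c * d) * norm w"
    using A_bound by (intro mult_right_mono) (auto simp: d_def norm_minus_commute[of u vt])
  finally have A_term: "blinfun_apply (A vt) w - blinfun_apply (A u) w \<le> (c * d) * norm w"
    by (simp add: A_diff blinfun.diff_left)

  have "X = blinfun_apply (A u - l) w + blinfun_apply (A u - l) (v - u)"
    by (simp add: X_def w_def algebra_simps flip: blinfun.add_right)
  then have X_ge: "blinfun_apply (A u) w - blinfun_apply l w \<le> X"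
    using u(2) v by (simp add: blinfun.diff_left)

  have "\<alpha>t * (norm w)\<^sup>2 \<le> At w w"
    using At_elliptic wV by blast
  also have "\<dots> \<le> At vt w - lt w"
    using At_split test_ut by simp
  also have "\<dots> = - R w + (blinfun_apply (A vt) w - blinfun_apply (A u) w)
                  + (blinfun_apply (A u) w - blinfun_apply l w)"
    by (simp add: R_def)
  also have "\<dots> \<le> (dual_norm_on Vt R + c * d) * norm w + X"
    using R_bound A_term X_ge by (simp add: distrib_right)
  finally have w_sq: "(norm w)\<^sup>2 \<le> 2 / \<alpha>t\<^sup>2 * ((dual_norm_on Vt R)\<^sup>2 + (c * d)\<^sup>2) + 2 / \<alpha>t * X"
    by (rule young_absorb[OF const_pos(4)])

  have "(norm (u - ut))\<^sup>2 \<le> 2 * d\<^sup>2 + 2 * (norm w)\<^sup>2"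
    using norm_add_sq_le[of "u - vt" w] by (simp add: w_def d_def)
  also have "\<dots> \<le> 2 * d\<^sup>2 + 2 * (2 / \<alpha>t\<^sup>2 * ((dual_norm_on Vt R)\<^sup>2 + (c * d)\<^sup>2) + 2 / \<alpha>t * X)"
    by (intro add_left_mono mult_left_mono w_sq) simp
  also have "\<dots> = (2 + 4 * c\<^sup>2 / \<alpha>t\<^sup>2) * d\<^sup>2 + 4 / \<alpha>t * X + 4 / \<alpha>t\<^sup>2 * (dual_norm_on Vt R)\<^sup>2"
    by (simp add: power_mult_distrib distrib_left distrib_right)
  finally show "(norm (u - ut))\<^sup>2 \<le>
      (2 + 4 * c\<^sup>2 / \<alpha>t\<^sup>2) * (norm (u - vt))\<^sup>2
      + 4 / \<alpha>t * blinfun_apply (A u - l) (vt - u + v - ut)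
      + 4 / \<alpha>t\<^sup>2 *
          (dual_norm_on Vt (\<lambda>w. (blinfun_apply (A vt) w - At vt w)
                                  - (blinfun_apply l w - lt w)))\<^sup>2"
    by (simp only: d_def X_def R_def)
qed

end
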